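(* For any increasing functions $f$ and $g$ defined on $\{0,1\}^{E}$, we have $$E_{\mu}(fg)\ge E_{\mu}(f)E_{\mu}(g).$$
   Context: Let $\alpha>0$ and $\beta\ge 0$ be fixed parameters. Let $G=(V,E)$ be a finite simple undirected graph with $V=\{1,\dots,m\}$, and let $e_i\in\mathbb{R}^m$ be the $i$th standard basis column vector. For $a=(a_{ij})_{(i,j)\in E}\in\{0,1\}^E$ define $$Q(a)=\alpha I+\beta\sum_{(i,j)\in E}a_{ij}(e_i-e_j)(e_i-e_j)^T,\qquad \Sigma(a)=Q(a)^{-1}$$ (each edge counted once; $Q(a)$ is positive definite). Let $\mu$ be the probability distribution on $\{0,1\}^E$ given by $$\mu(a)=\frac{|\Sigma(a)|^{1/2}}{\sum_{b\in\{0,1\}^E}|\Sigma(b)|^{1/2}},\qquad a\in\{0,1\}^E,$$ where $|\cdot|$ is the determinant. It is the edge marginal of the joint density on $\{0,1\}^E\times\mathbb{R}^m$ proportional to $\exp\{-\frac12(\alpha\sum_i x_i^2+\beta\sum_{(i,j)\in E}a_{ij}(x_i-x_j)^2)\}$. $E_\mu$ denotes expectation under $\mu$. A real-valued function $f$ on $\{0,1\}^E$ is increasing if $f(a)\le f(a')$ whenever $a_{ij}\le a'_{ij}$ for all $(i,j)\in E$. *)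

theory Defs
  imports "HOL-Analysis.Analysis" "HOL-Probability.Probability"
begin

text \<open>The vertex set is a finite type \<open>'n\<close>; a simple undirected graph on it is given by its set of
  edges, each a two-element set of vertices.\<close>

definition simple_graph :: "'n::finite set set \<Rightarrow> bool" where
  "simple_graph E \<longleftrightarrow> (\<forall>e\<in>E. card e = 2)"

definition configs :: "'n::finite set set \<Rightarrow> ('n set \<Rightarrow> real) set" where
  "configs E = E \<rightarrow>\<^sub>E {0, 1}"

text \<open>The matrix \<open>(e\<^sub>i - e\<^sub>j) (e\<^sub>i - e\<^sub>j)\<^sup>T\<close> depends only on the unordered pair \<open>{i, j}\<close>, so the
  description below is unique whenever \<open>card e = 2\<close> (see \<open>edge_matrix_insert\<close>).\<close>

definition edge_matrix :: "'n::finite set \<Rightarrow> real^'n^'n" where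
  "edge_matrix e = (THE M. \<exists>i j. e = {i, j} \<and>
     M = (columnvector (axis i 1 - axis j 1) :: real^1^'n) **
         (rowvector (axis i 1 - axis j 1) :: real^'n^1))"

definition prec_matrix ::
    "real \<Rightarrow> real \<Rightarrow> 'n::finite set set \<Rightarrow> ('n set \<Rightarrow> real) \<Rightarrow> real^'n^'n" where
  "prec_matrix \<alpha> \<beta> E a = \<alpha> *\<^sub>R mat 1 + \<beta> *\<^sub>R (\<Sum>e\<in>E. a e *\<^sub>R edge_matrix e)"

definition cov_matrix ::
    "real \<Rightarrow> real \<Rightarrow> 'n::finite set set \<Rightarrow> ('n set \<Rightarrow> real) \<Rightarrow> real^'n^'n" where
  "cov_matrix \<alpha> \<beta> E a = matrix_inv (prec_matrix \<alpha> \<beta> E a)"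

definition edge_weight ::
    "real \<Rightarrow> real \<Rightarrow> 'n::finite set set \<Rightarrow> ('n set \<Rightarrow> real) \<Rightarrow> real" where
  "edge_weight \<alpha> \<beta> E a = sqrt (det (cov_matrix \<alpha> \<beta> E a))"

text \<open>\<open>embed_pmf\<close> is meaningful only for a nonnegative function of total mass 1; the lemma
  \<open>pmf_edge_pmf\<close> establishes this for the parameters of interest.\<close>

definition edge_pmf ::
    "real \<Rightarrow> real \<Rightarrow> 'n::finite set set \<Rightarrow> ('n set \<Rightarrow> real) pmf" where
  "edge_pmf \<alpha> \<beta> E = embed_pmf (\<lambda>a. if a \<in> configs E
     then edge_weight \<alpha> \<beta> E a / (\<Sum>b\<in>configs E. edge_weight \<alpha> \<beta> E b) else 0)"

text \<open>Members of \<open>configs E\<close> coincide outside \<open>E\<close>, so the pointwise order of functions restricted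
  to \<open>configs E\<close> is the coordinatewise order over \<open>E\<close>.\<close>

definition increasing_on_configs ::
    "'n::finite set set \<Rightarrow> (('n set \<Rightarrow> real) \<Rightarrow> real) \<Rightarrow> bool" where
  "increasing_on_configs E f \<longleftrightarrow> mono_on (configs E) f"

lemma increasing_on_configs_iff:
  "increasing_on_configs E f \<longleftrightarrow>
     (\<forall>a\<in>configs E. \<forall>a'\<in>configs E. (\<forall>e\<in>E. a e \<le> a' e) \<longrightarrow> f a \<le> f a')"
proof -
  have "a \<le> a' \<longleftrightarrow> (\<forall>e\<in>E. a e \<le> a' e)" if "a \<in> configs E" "a' \<in> configs E"
    for a a' :: "'a set \<Rightarrow> real"
    using that unfolding le_fun_def configs_def by (metis PiE_arb order_refl)
  then show ?thesis
    by (auto simp: increasing_on_configs_def monotone_on_def)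
qed

lemma finite_configs [simp]: "finite (configs E)"
  unfolding configs_def by (intro finite_PiE) auto

lemma configs_nonempty: "configs E \<noteq> {}"
  by (auto simp: configs_def PiE_eq_empty_iff)

lemma edge_matrix_insert:
  "edge_matrix {i, j} = (columnvector (axis i 1 - axis j 1) :: real^1^'n::finite) **
     (rowvector (axis i 1 - axis j 1) :: real^'n^1)"
  unfolding edge_matrix_def
proof (rule the_equality, goal_cases)
  case 1
  then show ?case by blast
next
  case (2 M)
  then obtain k l where kl: "{i, j} = {k, l}"
    and M: "M = (columnvector (axis k 1 - axis l 1) :: real^1^'n) **
         (rowvector (axis k 1 - axis l 1) :: real^'n^1)"
    by blast
  have swap: "(columnvector (x - y) :: real^1^'n) ** (rowvector (x - y) :: real^'n^1) =
        (columnvector (y - x) :: real^1^'n) ** (rowvector (y - x) :: real^'n^1)" for x y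
    by (simp add: vec_eq_iff matrix_matrix_mult_def columnvector_def rowvector_def algebra_simps)
  from kl have "k = i \<and> l = j \<or> k = j \<and> l = i"
    by (auto simp: doubleton_eq_iff)
  then show ?case
    using M swap by auto
qed

lemma edge_matrix_inner:
  fixes x :: "real^'n::finite"
  shows "x \<bullet> (edge_matrix {i, j} *v x) = (x $ i - x $ j)\<^sup>2"
proof -
  define v :: "real^'n" where "v = axis i 1 - axis j 1"
  have vx: "v \<bullet> x = x $ i - x $ j"
    by (simp add: v_def inner_diff_left inner_axis')
  have "edge_matrix {i, j} *v x = (v \<bullet> x) *\<^sub>R v"
    unfolding edge_matrix_insert v_def[symmetric]
    by (simp add: vec_eq_iff matrix_vector_mult_def matrix_matrix_mult_def columnvector_def
        rowvector_def inner_vec_def sum_distrib_left sum_distrib_right mult_ac)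
  then show ?thesis
    using vx by (simp add: power2_eq_square inner_commute)
qed

lemma prec_matrix_inner:
  fixes x :: "real^'n::finite"
  shows "x \<bullet> (prec_matrix \<alpha> \<beta> E a *v x) =
    \<alpha> * (x \<bullet> x) + \<beta> * (\<Sum>e\<in>E. a e * (x \<bullet> (edge_matrix e *v x)))"
proof -
  have "(\<Sum>e\<in>F. a e *\<^sub>R edge_matrix e) *v x = (\<Sum>e\<in>F. a e *\<^sub>R (edge_matrix e *v x))"
    if "finite F" for F
    using that by induction
      (auto simp: matrix_vector_mult_add_rdistrib scaleR_matrix_vector_assoc[symmetric])
  then show ?thesis
    by (simp add: prec_matrix_def matrix_vector_mult_add_rdistrib
        scaleR_matrix_vector_assoc[symmetric] inner_add_right inner_sum_right)
qed

lemma prec_matrix_posdef: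
  fixes x :: "real^'n::finite"
  assumes "\<alpha> > 0" "\<beta> \<ge> 0" "simple_graph E" "a \<in> configs E" "x \<noteq> 0"
  shows "x \<bullet> (prec_matrix \<alpha> \<beta> E a *v x) > 0"
proof -
  have "a e * (x \<bullet> (edge_matrix e *v x)) \<ge> 0" if "e \<in> E" for e
  proof -
    from that assms obtain i j where "e = {i, j}"
      by (auto simp: simple_graph_def card_2_iff)
    moreover have "a e \<ge> 0"
      using assms(4) that by (force simp: configs_def PiE_iff)
    ultimately show ?thesis
      by (simp add: edge_matrix_inner)
  qed
  then have "\<beta> * (\<Sum>e\<in>E. a e * (x \<bullet> (edge_matrix e *v x))) \<ge> 0"
    using assms(2) by (simp add: sum_nonneg)
  moreover have "\<alpha> * (x \<bullet> x) > 0"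
    using assms by simp
  ultimately show ?thesis
    by (simp add: prec_matrix_inner)
qed

lemma det_prec_matrix_pos:
  fixes E :: "'n::finite set set"
  assumes "\<alpha> > 0" "\<beta> \<ge> 0" "simple_graph E" "a \<in> configs E"
  shows "det (prec_matrix \<alpha> \<beta> E a) > 0"
proof (rule ccontr)
  assume neg: "\<not> det (prec_matrix \<alpha> \<beta> E a) > 0"
  have "prec_matrix \<alpha> 0 E a = (\<chi> i j. if i = j then \<alpha> else 0)"
    by (simp add: prec_matrix_def mat_def vec_eq_iff)
  then have "det (prec_matrix \<alpha> 0 E a) = \<alpha> ^ CARD('n)"
    by (simp add: det_diagonal)
  then have pos: "det (prec_matrix \<alpha> 0 E a) > 0"
    using assms by simp
  have "continuous_on {0..\<beta>} (\<lambda>b. det (prec_matrix \<alpha> b E a))"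
    unfolding det_def prec_matrix_def
    by (intro continuous_intros)
  from IVT2'[of "\<lambda>b. det (prec_matrix \<alpha> b E a)" \<beta> 0 0] this neg pos assms(2)
  obtain b where b: "0 \<le> b" "b \<le> \<beta>" "det (prec_matrix \<alpha> b E a) = 0"
    by force
  then have "\<not> invertible (prec_matrix \<alpha> b E a)"
    by (simp add: invertible_det_nz)
  then obtain x where "x \<noteq> 0" "prec_matrix \<alpha> b E a *v x = 0"
    by (auto simp: invertible_left_inverse matrix_left_invertible_ker)
  with prec_matrix_posdef[OF assms(1) b(1) assms(3,4)] show False
    by force
qed

lemma edge_weight_pos:
  assumes "\<alpha> > 0" "\<beta> \<ge> 0" "simple_graph E" "a \<in> configs E"
  shows "edge_weight \<alpha> \<beta> E a > 0"
proof -
  let ?Q = "prec_matrix \<alpha> \<beta> E a"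
  have Q: "det ?Q > 0"
    using det_prec_matrix_pos[OF assms] .
  then have "invertible ?Q"
    by (simp add: invertible_det_nz)
  then have "?Q ** matrix_inv ?Q = mat 1"
    unfolding matrix_inv_def invertible_def by (rule someI2_ex) simp
  then have "det ?Q * det (matrix_inv ?Q) = 1"
    by (metis det_I det_mul)
  with Q have "det (matrix_inv ?Q) > 0"
    by (metis zero_less_mult_pos zero_less_one)
  then show ?thesis
    by (simp add: edge_weight_def cov_matrix_def)
qed

lemma pmf_edge_pmf:
  assumes "\<alpha> > 0" "\<beta> \<ge> 0" "simple_graph E"
  shows "pmf (edge_pmf \<alpha> \<beta> E) a = (if a \<in> configs E
     then edge_weight \<alpha> \<beta> E a / (\<Sum>b\<in>configs E. edge_weight \<alpha> \<beta> E b) else 0)"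
proof -
  let ?Z = "\<Sum>b\<in>configs E. edge_weight \<alpha> \<beta> E b"
  let ?p = "\<lambda>a. if a \<in> configs E then edge_weight \<alpha> \<beta> E a / ?Z else 0"
  have Z: "?Z > 0"
    using edge_weight_pos[OF assms] configs_nonempty by (intro sum_pos) auto
  have nonneg: "?p x \<ge> 0" for x
    using edge_weight_pos[OF assms, of x] Z by auto
  have "(\<integral>\<^sup>+ x. ennreal (?p x) \<partial>count_space UNIV) = (\<Sum>x\<in>configs E. ennreal (?p x))"
    by (intro nn_integral_count_space'[where A = "configs E"]) auto
  also have "\<dots> = ennreal (\<Sum>x\<in>configs E. ?p x)"
    by (rule sum_ennreal) (rule nonneg)
  also have "(\<Sum>x\<in>configs E. ?p x) = 1"
    using Z by (simp add: sum_divide_distrib[symmetric])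
  finally show ?thesis
    unfolding edge_pmf_def by (subst pmf_embed_pmf) (use nonneg in auto)
qed

end

theory Submission
  imports Defs
begin

text \<open>Identify a configuration with its set \<open>S\<close> of open edges. Opening one more edge \<open>{i, j}\<close>
  multiplies \<open>det Q(S)\<close> by \<open>1 + \<beta> v \<bullet> Q(S)\<^sup>-\<^sup>1 v\<close> with \<open>v = e\<^sub>i - e\<^sub>j\<close>, and this factor decreases in \<open>S\<close>
  because \<open>Q(S)\<close> increases in the Loewner order. Hence \<open>S \<mapsto> ln (det Q(S))\<close> is submodular, the weight
  \<open>(det Q(S))\<^sup>-\<^sup>1\<^sup>/\<^sup>2\<close> satisfies the FKG lattice condition, and the FKG inequality follows from the
  four functions theorem of Ahlswede and Daykin.\<close>

section \<open>The four functions theorem and the FKG inequality on a power set\<close>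

text \<open>This is the case of a one-element ground set, the index telling whether the element is
  present. The products with equal indices compare termwise. The mixed products must be treated
  together: each is bounded by \<open>r1 * s0\<close>, but only their product brings in
  \<open>r0 * s1\<close>.\<close>

lemma four_functions_one_point:
  fixes p0 :: real
  assumes nonneg: "0 \<le> p0" "0 \<le> p1" "0 \<le> q0" "0 \<le> q1" "0 \<le> r0" "0 \<le> r1" "0 \<le> s0" "0 \<le> s1"
    and "p0 * q0 \<le> r0 * s0" "p0 * q1 \<le> r1 * s0" "p1 * q0 \<le> r1 * s0" "p1 * q1 \<le> r1 * s1"
  shows "(p0 + p1) * (q0 + q1) \<le> (r0 + r1) * (s0 + s1)"
proof -
  define x where "x = p0 * q1"
  define y where "y = p1 * q0"
  define z where "z = r1 * s0"
  have xyz: "x \<le> z" "y \<le> z" "0 \<le> x" "0 \<le> y" "0 \<le> z"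
    using assms by (simp_all add: x_def y_def z_def)
  have "x * y = (p0 * q0) * (p1 * q1)"
    by (simp add: x_def y_def)
  also have "\<dots> \<le> (r0 * s0) * (r1 * s1)"
    by (rule mult_mono) (use assms in auto)
  also have "\<dots> = z * (r0 * s1)"
    by (simp add: z_def)
  finally have xy: "x * y \<le> z * (r0 * s1)" .
  have "x + y \<le> z + r0 * s1"
  proof (cases "z = 0")
    case True
    then show ?thesis using xyz nonneg by simp
  next
    case False
    \<comment> \<open>Both factors are nonnegative. Expanding bounds \<open>x + y\<close> by
      \<open>z + x * y / z\<close>, here multiplied through by \<open>z\<close>.\<close>
    have "0 \<le> (z - x) * (z - y)" using xyz by simp
    then have "z * (x + y) \<le> z * z + x * y" by (simp add: algebra_simps)
    also have "\<dots> \<le> z * (z + r0 * s1)" using xy by (simp add: algebra_simps)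
    finally show ?thesis using False xyz by simp
  qed
  moreover have "p0 * q0 + p1 * q1 \<le> r0 * s0 + r1 * s1"
    using assms by simp
  ultimately show ?thesis
    by (simp add: x_def y_def z_def algebra_simps)
qed

lemma sum_Pow_insert:
  fixes h :: "'a set \<Rightarrow> real"
  assumes "finite S" "x \<notin> S"
  shows "sum h (Pow (insert x S)) = (\<Sum>A\<in>Pow S. h A + h (insert x A))"
proof -
  have inj: "inj_on (insert x) (Pow S)"
    using assms(2) by (auto simp: inj_on_def)
  have "sum h (Pow (insert x S)) = sum h (Pow S) + sum h (insert x ` Pow S)"
    unfolding Pow_insert using assms by (intro sum.union_disjoint) auto
  then show ?thesis
    by (simp add: sum.reindex[OF inj] sum.distrib)
qed

text \<open>Induction on the ground set: summing each function over the absence and presence of the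
  new element \<open>x\<close> gives four functions on subsets of \<open>S\<close>. They inherit the
  product hypothesis by \<open>four_functions_one_point\<close>, applied for each fixed pair
  \<open>A\<close>, \<open>B\<close>.\<close>

lemma four_functions:
  fixes p q r s :: "'a set \<Rightarrow> real"
  assumes "finite S"
    and "\<And>A. A \<subseteq> S \<Longrightarrow> 0 \<le> p A" "\<And>A. A \<subseteq> S \<Longrightarrow> 0 \<le> q A"
    and "\<And>A. A \<subseteq> S \<Longrightarrow> 0 \<le> r A" "\<And>A. A \<subseteq> S \<Longrightarrow> 0 \<le> s A"
    and "\<And>A B. A \<subseteq> S \<Longrightarrow> B \<subseteq> S \<Longrightarrow> p A * q B \<le> r (A \<union> B) * s (A \<inter> B)"
  shows "sum p (Pow S) * sum q (Pow S) \<le> sum r (Pow S) * sum s (Pow S)"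
  using assms
proof (induction S arbitrary: p q r s rule: finite_induct)
  case empty
  from empty(5)[of "{}" "{}"] show ?case by simp
next
  case (insert x S)
  have sub: "A \<subseteq> insert x S" "insert x A \<subseteq> insert x S" "x \<notin> A" if "A \<subseteq> S" for A
    using that insert.hyps by auto
  show ?case
    unfolding sum_Pow_insert[OF insert.hyps]
  proof (rule insert.IH)
    fix A B assume AB: "A \<subseteq> S" "B \<subseteq> S"
    then have un: "A \<union> B \<subseteq> S" and int: "A \<inter> B \<subseteq> S" by auto
    note a = sub[OF AB(1)] and b = sub[OF AB(2)]
    note u = sub[OF un] and i = sub[OF int]
    show "(p A + p (insert x A)) * (q B + q (insert x B)) \<le>
        (r (A \<union> B) + r (insert x (A \<union> B))) * (s (A \<inter> B) + s (insert x (A \<inter> B)))"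
    proof (rule four_functions_one_point)
      show "p A * q B \<le> r (A \<union> B) * s (A \<inter> B)"
        by (rule insert.prems(5)[OF a(1) b(1)])
      show "p A * q (insert x B) \<le> r (insert x (A \<union> B)) * s (A \<inter> B)"
        using insert.prems(5)[OF a(1) b(2)] a(3) by simp
      show "p (insert x A) * q B \<le> r (insert x (A \<union> B)) * s (A \<inter> B)"
        using insert.prems(5)[OF a(2) b(1)] b(3) by simp
      show "p (insert x A) * q (insert x B) \<le> r (insert x (A \<union> B)) * s (insert x (A \<inter> B))"
        using insert.prems(5)[OF a(2) b(2)] by simp
    qed (use insert.prems(1-4) a b u i in auto)
  qed (use insert.prems(1-4) sub in auto)
qed

text \<open>The four functions theorem is applied to \<open>w * f'\<close>, \<open>w * g'\<close>,
  \<open>w * f' * g'\<close> and \<open>w\<close>, where \<open>f'\<close> and \<open>g'\<close> are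
  nonnegative shifts of \<open>f\<close> and \<open>g\<close>.\<close>

lemma FKG_inequality:
  fixes w f g :: "'a set \<Rightarrow> real"
  assumes fin: "finite S"
    and w0: "\<And>A. A \<subseteq> S \<Longrightarrow> 0 \<le> w A"
    and wl: "\<And>A B. A \<subseteq> S \<Longrightarrow> B \<subseteq> S \<Longrightarrow> w A * w B \<le> w (A \<union> B) * w (A \<inter> B)"
    and f: "mono_on (Pow S) f" and g: "mono_on (Pow S) g"
  shows "(\<Sum>A\<in>Pow S. w A * f A) * (\<Sum>A\<in>Pow S. w A * g A) \<le>
    (\<Sum>A\<in>Pow S. w A * (f A * g A)) * (\<Sum>A\<in>Pow S. w A)"
proof -
  \<comment> \<open>By monotonicity the value at \<open>{}\<close> is the minimum, so subtracting it
    yields the nonnegativity that the four functions theorem demands.\<close>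
  define f' where "f' A = f A - f {}" for A
  define g' where "g' A = g A - g {}" for A
  have fm: "0 \<le> f' A" "0 \<le> g' A" if "A \<subseteq> S" for A
    using that f g by (auto simp: f'_def g'_def monotone_on_def)
  have fu: "f' A \<le> f' (A \<union> B)" "g' B \<le> g' (A \<union> B)" if "A \<subseteq> S" "B \<subseteq> S" for A B
    using that monotone_onD[OF f, of A "A \<union> B"] monotone_onD[OF g, of B "A \<union> B"]
    by (auto simp: f'_def g'_def)
  have main: "(\<Sum>A\<in>Pow S. w A * f' A) * (\<Sum>A\<in>Pow S. w A * g' A) \<le>
    (\<Sum>A\<in>Pow S. w A * (f' A * g' A)) * (\<Sum>A\<in>Pow S. w A)"
  proof (rule four_functions[OF fin])
    fix A B assume AB: "A \<subseteq> S" "B \<subseteq> S"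
    have "w A * f' A * (w B * g' B) = (w A * w B) * (f' A * g' B)"
      by simp
    also have "\<dots> \<le> (w (A \<union> B) * w (A \<inter> B)) * (f' (A \<union> B) * g' (A \<union> B))"
    proof (rule mult_mono)
      show "f' A * g' B \<le> f' (A \<union> B) * g' (A \<union> B)"
        using fu[OF AB] fm[of "A \<union> B"] fm[of B] AB by (intro mult_mono) auto
    qed (use AB fm w0 wl in \<open>auto simp: le_infI1\<close>)
    finally show "w A * f' A * (w B * g' B) \<le> w (A \<union> B) * (f' (A \<union> B) * g' (A \<union> B)) * w (A \<inter> B)"
      by (simp add: mult_ac)
  qed (use fm w0 in auto)
  have f'_sum: "(\<Sum>A\<in>Pow S. w A * f' A) = (\<Sum>A\<in>Pow S. w A * f A) - f {} * sum w (Pow S)"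
    by (simp add: f'_def algebra_simps sum_subtractf sum_distrib_left)
  have g'_sum: "(\<Sum>A\<in>Pow S. w A * g' A) = (\<Sum>A\<in>Pow S. w A * g A) - g {} * sum w (Pow S)"
    by (simp add: g'_def algebra_simps sum_subtractf sum_distrib_left)
  have fg'_sum: "(\<Sum>A\<in>Pow S. w A * (f' A * g' A)) = (\<Sum>A\<in>Pow S. w A * (f A * g A)) -
      f {} * (\<Sum>A\<in>Pow S. w A * g A) - g {} * (\<Sum>A\<in>Pow S. w A * f A) +
      f {} * g {} * sum w (Pow S)"
    by (simp add: f'_def g'_def algebra_simps sum_subtractf sum.distrib sum_distrib_left)
  \<comment> \<open>The difference of the two sides is a covariance up to normalisation, so all
    terms in \<open>f {}\<close> and \<open>g {}\<close> cancel.\<close>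
  show ?thesis
    using main unfolding f'_sum g'_sum fg'_sum by (simp add: algebra_simps)
qed

section \<open>The matrix determinant lemma for rank-one updates\<close>

text \<open>Cramer's rule for the identity matrix, in row form.\<close>

lemma det_row_replaced:
  fixes v :: "real^'n::finite"
  shows "det (\<chi> i. if i = k then v else axis i 1) = v $ k"
proof -
  have "(\<Sum>i\<in>UNIV. v $ i *s row i (mat 1 :: real^'n^'n)) = v"
    by (simp add: vec_eq_iff row_def mat_def if_distrib[of "\<lambda>z. _ * z"] cong: if_cong)
  moreover have "row i (mat 1 :: real^'n^'n) = axis i 1" for i
    by (auto simp: vec_eq_iff row_def mat_def axis_def)
  ultimately show ?thesis
    using cramer_lemma_transpose[of k v "mat 1 :: real^'n^'n"] by (simp cong: if_cong)
qed

text \<open>Since row \<open>k\<close> is \<open>v\<close> itself, the added multiples of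
  \<open>v\<close> in the other rows are row operations and leave the determinant unchanged.\<close>

lemma det_row_replaced_update:
  fixes u v :: "real^'n::finite"
  assumes "finite S" "k \<notin> S"
  shows "det (\<chi> i. if i = k then v else axis i 1 + (if i \<in> S then u $ i *s v else 0)) = v $ k"
  using assms
proof (induction S rule: finite_induct)
  case empty
  then show ?case using det_row_replaced[of k v] by (simp cong: if_cong)
next
  case (insert l S)
  let ?A = "\<chi> i. if i = k then v else axis i 1 + (if i \<in> S then u $ i *s v else 0)"
  have "det (\<chi> i. if i = l then row l ?A + u $ l *s row k ?A else row i ?A) = det ?A"
    using insert by (intro det_row_operation) auto
  moreover have "(\<chi> i. if i = l then row l ?A + u $ l *s row k ?A else row i ?A) =
      (\<chi> i. if i = k then v else axis i 1 + (if i \<in> insert l S then u $ i *s v else 0))"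
    using insert by (auto simp: vec_eq_iff row_def)
  ultimately show ?case using insert by simp
qed

text \<open>For \<open>S = UNIV\<close> the matrix is I + u v^T; updating only the rows in
  \<open>S\<close> permits induction. Linearity in the new row \<open>k\<close> splits off a term
  evaluated by \<open>det_row_replaced_update\<close>.\<close>

lemma det_identity_plus_rank_one_rows:
  fixes u v :: "real^'n::finite"
  assumes "finite S"
  shows "det (\<chi> i. axis i 1 + (if i \<in> S then u $ i *s v else 0)) = 1 + (\<Sum>i\<in>S. u $ i * v $ i)"
  using assms
proof (induction S rule: finite_induct)
  case empty
  have "(\<chi> i. axis i 1 + (if i \<in> {} then u $ i *s v else 0)) = (mat 1 :: real^'n^'n)"
    by (auto simp: vec_eq_iff mat_def axis_def)
  then show ?case by simp
next
  case (insert k S)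
  let ?b = "\<lambda>i. axis i 1 + (if i \<in> S then u $ i *s v else 0)"
  have "det (\<chi> i. axis i 1 + (if i \<in> insert k S then u $ i *s v else 0)) =
      det (\<chi> i. if i = k then axis k 1 + u $ k *s v else ?b i)"
    by (intro arg_cong[where f = det]) (auto simp: vec_eq_iff)
  also have "\<dots> = det (\<chi> i. if i = k then axis k 1 else ?b i) +
      det (\<chi> i. if i = k then u $ k *s v else ?b i)"
    by (rule det_row_add)
  also have "(\<chi> i. if i = k then axis k 1 else ?b i) = (\<chi> i. ?b i)"
    using insert by (auto simp: vec_eq_iff)
  also have "det (\<chi> i. if i = k then u $ k *s v else ?b i) =
      u $ k * det (\<chi> i. if i = k then v else ?b i)"
    by (rule det_row_mul)
  also have "det (\<chi> i. if i = k then v else ?b i) = v $ k"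
    using det_row_replaced_update insert by blast
  finally show ?case using insert by simp
qed

text \<open>Because \<open>Q *v y = v\<close>, the updated matrix factors as Q (I + c y v^T). A
  solution \<open>y\<close> stands in for the inverse of \<open>Q\<close> applied to
  \<open>v\<close>.\<close>

lemma det_rank_one_update:
  fixes Q :: "real^'n::finite^'n" and v y :: "real^'n"
  assumes "Q *v y = v"
  shows "det (Q + c *\<^sub>R (\<chi> i j. v $ i * v $ j)) = det Q * (1 + c * (v \<bullet> y))"
proof -
  let ?R = "\<chi> i. axis i 1 + (if i \<in> UNIV then (c *\<^sub>R y) $ i *s v else 0)"
  have "(Q ** ?R) $ i $ j = (Q + c *\<^sub>R (\<chi> i j. v $ i * v $ j)) $ i $ j" for i j
  proof -
    have "(Q ** ?R) $ i $ j = (\<Sum>k\<in>UNIV. Q $ i $ k * (if k = j then 1 else 0)) +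
        c * v $ j * (\<Sum>k\<in>UNIV. Q $ i $ k * y $ k)"
      by (simp add: matrix_matrix_mult_def axis_def algebra_simps sum.distrib sum_distrib_left
          eq_commute cong: if_cong)
    also have "(\<Sum>k\<in>UNIV. Q $ i $ k * y $ k) = v $ i"
      using assms by (auto simp: vec_eq_iff matrix_vector_mult_def)
    also have "(\<Sum>k\<in>UNIV. Q $ i $ k * (if k = j then 1 else 0)) = Q $ i $ j"
      by (simp add: if_distrib[of "\<lambda>z. _ * z"] cong: if_cong)
    finally show ?thesis by simp
  qed
  then have Q: "Q + c *\<^sub>R (\<chi> i j. v $ i * v $ j) = Q ** ?R"
    by (simp add: vec_eq_iff)
  have "det ?R = 1 + c * (v \<bullet> y)"
    by (subst det_identity_plus_rank_one_rows)
      (auto simp: inner_vec_def sum_distrib_left mult_ac)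
  then show ?thesis
    unfolding Q det_mul by (rule arg_cong)
qed

section \<open>Configurations as sets of open edges\<close>

text \<open>\<open>restrict\<close> makes the function \<open>undefined\<close> outside
  \<open>E\<close>, as membership in the extensional function space \<open>configs E\<close>
  requires.\<close>

definition set_config :: "'n set set \<Rightarrow> 'n set set \<Rightarrow> 'n set \<Rightarrow> real" where
  "set_config E S = restrict (indicator S) E"

lemma set_config_in_configs: "set_config E S \<in> configs E"
  by (auto simp: set_config_def configs_def indicator_def)

lemma bij_betw_set_config: "bij_betw (set_config E) (Pow E) (configs E)"
proof (rule bij_betw_byWitness[where f' = "\<lambda>a. {e \<in> E. a e = 1}"])
  show "\<forall>S\<in>Pow E. {e \<in> E. set_config E S e = 1} = S"
    by (auto simp: set_config_def indicator_def split: if_splits)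
  show "\<forall>a\<in>configs E. set_config E {e \<in> E. a e = 1} = a"
    by (fastforce simp: set_config_def configs_def indicator_def fun_eq_iff restrict_def
        PiE_iff extensional_def)
qed (auto simp: set_config_in_configs)

lemma set_config_mono: "mono (set_config E)"
  by (auto simp: mono_def le_fun_def set_config_def restrict_def indicator_def)

text \<open>With \<open>S\<close> also as the ambient edge set, every edge is open and the matrix
  depends on \<open>S\<close> alone, so different subgraphs can be compared without mentioning
  \<open>E\<close>.\<close>

abbreviation subgraph_prec :: "real \<Rightarrow> real \<Rightarrow> 'n::finite set set \<Rightarrow> real^'n^'n" where
  "subgraph_prec \<alpha> \<beta> S \<equiv> prec_matrix \<alpha> \<beta> S (set_config S S)"

lemma subgraph_prec_eq: "subgraph_prec \<alpha> \<beta> S = \<alpha> *\<^sub>R mat 1 + \<beta> *\<^sub>R (\<Sum>e\<in>S. edge_matrix e)"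
  by (simp add: prec_matrix_def set_config_def)

lemma prec_matrix_set_config:
  assumes "S \<subseteq> E"
  shows "prec_matrix \<alpha> \<beta> E (set_config E S) = subgraph_prec \<alpha> \<beta> S"
proof -
  have "(\<Sum>e\<in>E. set_config E S e *\<^sub>R edge_matrix e) = (\<Sum>e\<in>S. edge_matrix e)"
    by (rule sum.mono_neutral_cong_right) (use assms in \<open>auto simp: set_config_def\<close>)
  then show ?thesis
    by (simp add: prec_matrix_def[of _ _ E] subgraph_prec_eq)
qed

section \<open>Symmetry, quadratic forms and the Loewner order\<close>

lemma edge_matrix_nth:
  "edge_matrix {i, j} =
    (\<chi> k l. (axis i 1 - axis j 1 :: real^'n::finite) $ k * (axis i 1 - axis j 1 :: real^'n) $ l)"
  unfolding edge_matrix_insert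
  by (simp add: vec_eq_iff matrix_matrix_mult_def columnvector_def rowvector_def)

lemma transpose_subgraph_prec:
  assumes "simple_graph S"
  shows "transpose (subgraph_prec \<alpha> \<beta> S) = subgraph_prec \<alpha> \<beta> S"
proof -
  have "edge_matrix e $ k $ l = edge_matrix e $ l $ k" if "e \<in> S" for e k l
    using assms that by (auto simp: simple_graph_def card_2_iff edge_matrix_nth mult.commute)
  then show ?thesis
    unfolding subgraph_prec_eq by (auto simp: vec_eq_iff transpose_def mat_def)
qed

text \<open>Each additional edge contributes a squared difference to the quadratic form.\<close>

lemma subgraph_prec_inner_mono:
  assumes "0 \<le> \<beta>" "simple_graph T" "S \<subseteq> T"
  shows "x \<bullet> (subgraph_prec \<alpha> \<beta> S *v x) \<le> x \<bullet> (subgraph_prec \<alpha> \<beta> T *v x)"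
proof -
  have "0 \<le> x \<bullet> (edge_matrix e *v x)" if "e \<in> T" for e
    using assms(2) that by (auto simp: simple_graph_def card_2_iff edge_matrix_inner)
  then have "(\<Sum>e\<in>S. x \<bullet> (edge_matrix e *v x)) \<le> (\<Sum>e\<in>T. x \<bullet> (edge_matrix e *v x))"
    using assms(3) by (intro sum_mono2) auto
  then show ?thesis
    using assms(1) by (simp add: prec_matrix_inner set_config_def mult_left_mono)
qed

text \<open>Inversion reverses the Loewner order, because \<open>v \<bullet> Q\<^sup>-\<^sup>1 v\<close> is the maximum over \<open>x\<close>
  of \<open>2 (v \<bullet> x) - x \<bullet> Q x\<close>.\<close>

lemma inverse_form_antimono:
  fixes P Q :: "real^'n::finite^'n"
  assumes le: "\<And>x. x \<bullet> (P *v x) \<le> x \<bullet> (Q *v x)" and pos: "\<And>x. 0 \<le> x \<bullet> (P *v x)"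
    and sym: "transpose P = P" and "P *v y = v" and "Q *v x = v"
  shows "v \<bullet> x \<le> v \<bullet> y"
proof -
  have "y \<bullet> (P *v x) = v \<bullet> x"
    using assms(4) sym by (metis dot_lmul_matrix vector_transpose_matrix)
  \<comment> \<open>This expands the nonnegative form of \<open>P\<close> at \<open>x - y\<close>.
    Afterwards \<open>x \<bullet> (P *v x)\<close> is replaced by its upper bound
    \<open>x \<bullet> (Q *v x)\<close>, which equals \<open>v \<bullet> x\<close>.\<close>
  then have "0 \<le> x \<bullet> (P *v x) - 2 * (v \<bullet> x) + v \<bullet> y"
    using pos[of "x - y"] assms(4)
    by (simp add: matrix_vector_mult_diff_distrib inner_diff_left inner_diff_right inner_commute)
  then show ?thesis
    using le[of x] assms(5) by (simp add: inner_commute)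
qed

section \<open>Submodularity of the log-determinant\<close>

context
  fixes \<alpha> \<beta> :: real
  assumes \<alpha>: "0 < \<alpha>" and \<beta>: "0 \<le> \<beta>"
begin

lemma det_subgraph_prec_pos: "simple_graph S \<Longrightarrow> 0 < det (subgraph_prec \<alpha> \<beta> S)"
  using det_prec_matrix_pos[OF \<alpha> \<beta>] set_config_in_configs by blast

text \<open>Opening \<open>e\<close> multiplies the determinants for \<open>B\<close> and
  \<open>A\<close> by \<open>1 + \<beta> * (v \<bullet> x)\<close> and
  \<open>1 + \<beta> * (v \<bullet> y)\<close>, which \<open>inverse_form_antimono\<close> compares.
  The ratios are cross-multiplied.\<close>

lemma det_subgraph_prec_insert:
  fixes B :: "'n::finite set set"
  assumes "simple_graph (insert e B)" "A \<subseteq> B" "e \<notin> B"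
  shows "det (subgraph_prec \<alpha> \<beta> (insert e B)) * det (subgraph_prec \<alpha> \<beta> A) \<le>
    det (subgraph_prec \<alpha> \<beta> (insert e A)) * det (subgraph_prec \<alpha> \<beta> B)"
proof -
  have B: "simple_graph B" and A: "simple_graph A"
    using assms by (auto simp: simple_graph_def)
  obtain i j where e: "e = {i, j}"
    using assms(1) by (auto simp: simple_graph_def card_2_iff)
  define v :: "real^'n" where "v = axis i 1 - axis j 1"
  have em: "edge_matrix e = (\<chi> k l. v $ k * v $ l)"
    by (simp add: e edge_matrix_nth v_def)
  have ins: "subgraph_prec \<alpha> \<beta> (insert e S) = subgraph_prec \<alpha> \<beta> S + \<beta> *\<^sub>R (\<chi> k l. v $ k * v $ l)"
    if "e \<notin> S" for S
    using that by (simp add: subgraph_prec_eq em scaleR_add_right)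
  have ex: "\<exists>y. subgraph_prec \<alpha> \<beta> S *v y = v" if "simple_graph S" for S
    using det_subgraph_prec_pos[OF that]
    by (metis invertible_det_nz invertible_right_inverse matrix_right_invertible_surjective
        less_irrefl surjD)
  obtain x where x: "subgraph_prec \<alpha> \<beta> B *v x = v" using ex[OF B] by blast
  obtain y where y: "subgraph_prec \<alpha> \<beta> A *v y = v" using ex[OF A] by blast
  have "0 \<le> z \<bullet> (subgraph_prec \<alpha> \<beta> A *v z)" for z
    using prec_matrix_posdef[OF \<alpha> \<beta> A set_config_in_configs, of z A] by (cases "z = 0") auto
  then have "v \<bullet> x \<le> v \<bullet> y"
    by (intro inverse_form_antimono[OF subgraph_prec_inner_mono[OF \<beta> B assms(2)] _
        transpose_subgraph_prec[OF A] y x])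
  then have "1 + \<beta> * (v \<bullet> x) \<le> 1 + \<beta> * (v \<bullet> y)"
    using \<beta> by (simp add: mult_left_mono)
  then have "det (subgraph_prec \<alpha> \<beta> A) * det (subgraph_prec \<alpha> \<beta> B) * (1 + \<beta> * (v \<bullet> x)) \<le>
      det (subgraph_prec \<alpha> \<beta> A) * det (subgraph_prec \<alpha> \<beta> B) * (1 + \<beta> * (v \<bullet> y))"
    using det_subgraph_prec_pos[OF A] det_subgraph_prec_pos[OF B] by (intro mult_left_mono) auto
  moreover have "e \<notin> A" using assms by auto
  ultimately show ?thesis
    by (simp add: ins assms(3) det_rank_one_update[OF x] det_rank_one_update[OF y] mult_ac)
qed

text \<open>The edges of \<open>C\<close> are opened one at a time, and the single-edge inequalities
  telescope.\<close>

lemma det_subgraph_prec_union: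
  fixes B :: "'n::finite set set"
  assumes "finite C" "simple_graph (B \<union> C)" "A \<subseteq> B" "B \<inter> C = {}"
  shows "det (subgraph_prec \<alpha> \<beta> (B \<union> C)) * det (subgraph_prec \<alpha> \<beta> A) \<le>
    det (subgraph_prec \<alpha> \<beta> (A \<union> C)) * det (subgraph_prec \<alpha> \<beta> B)"
  using assms
proof (induction C rule: finite_induct)
  case empty
  then show ?case by simp
next
  case (insert e C)
  let ?d = "\<lambda>S. det (subgraph_prec \<alpha> \<beta> S)"
  have sg: "simple_graph (B \<union> C)" "simple_graph (A \<union> C)" "simple_graph A"
      "simple_graph (A \<union> insert e C)"
    using insert.prems by (auto simp: simple_graph_def)
  note pos = sg[THEN det_subgraph_prec_pos]
  have IH: "?d (B \<union> C) * ?d A \<le> ?d (A \<union> C) * ?d B"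
    using insert sg by auto
  have step: "?d (B \<union> insert e C) * ?d (A \<union> C) \<le> ?d (A \<union> insert e C) * ?d (B \<union> C)"
    using det_subgraph_prec_insert[of e "B \<union> C" "A \<union> C"] insert by auto
  \<comment> \<open>Multiplying by \<open>?d (A \<union> C)\<close> lets \<open>step\<close> and
    \<open>IH\<close> be chained through \<open>?d (B \<union> C)\<close>; positivity then allows
    this factor to be cancelled.\<close>
  have "(?d (B \<union> insert e C) * ?d A) * ?d (A \<union> C) = (?d (B \<union> insert e C) * ?d (A \<union> C)) * ?d A"
    by simp
  also have "\<dots> \<le> (?d (A \<union> insert e C) * ?d (B \<union> C)) * ?d A"
    using step pos by (intro mult_right_mono) auto
  also have "\<dots> = ?d (A \<union> insert e C) * (?d (B \<union> C) * ?d A)"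
    by simp
  also have "\<dots> \<le> ?d (A \<union> insert e C) * (?d (A \<union> C) * ?d B)"
    using IH pos by (intro mult_left_mono) auto
  also have "\<dots> = (?d (A \<union> insert e C) * ?d B) * ?d (A \<union> C)"
    by simp
  finally show ?case
    using pos by simp
qed

section \<open>The FKG lattice condition for the edge weights\<close>

lemma edge_weight_set_config:
  assumes "simple_graph E" "S \<subseteq> E"
  shows "edge_weight \<alpha> \<beta> E (set_config E S) = sqrt (inverse (det (subgraph_prec \<alpha> \<beta> S)))"
proof -
  let ?Q = "subgraph_prec \<alpha> \<beta> S"
  have "simple_graph S"
    using assms by (auto simp: simple_graph_def)
  then have "invertible ?Q"
    using det_subgraph_prec_pos by (force simp: invertible_det_nz)
  \<comment> \<open>\<open>matrix_inv\<close> is a Hilbert choice, so the inverse law rests on the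
    existence of an inverse.\<close>
  then have "?Q ** matrix_inv ?Q = mat 1"
    unfolding matrix_inv_def invertible_def by (rule someI2_ex) simp
  then have "det ?Q * det (matrix_inv ?Q) = 1"
    by (metis det_I det_mul)
  then show ?thesis
    by (simp add: edge_weight_def cov_matrix_def prec_matrix_set_config[OF assms(2)]
        inverse_unique)
qed

lemma edge_weight_log_supermodular:
  fixes E :: "'n::finite set set"
  assumes "simple_graph E" "A \<subseteq> E" "B \<subseteq> E"
  shows "edge_weight \<alpha> \<beta> E (set_config E A) * edge_weight \<alpha> \<beta> E (set_config E B) \<le>
    edge_weight \<alpha> \<beta> E (set_config E (A \<union> B)) * edge_weight \<alpha> \<beta> E (set_config E (A \<inter> B))"
proof -
  let ?d = "\<lambda>S. det (subgraph_prec \<alpha> \<beta> S)"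
  have sub: "A \<union> B \<subseteq> E" "A \<inter> B \<subseteq> E" using assms by auto
  have sg: "simple_graph S" if "S \<subseteq> E" for S
    using assms(1) that by (auto simp: simple_graph_def)
  have eq: "B \<union> (A - B) = A \<union> B" "A \<inter> B \<union> (A - B) = A" by auto
  \<comment> \<open>Adding \<open>A - B\<close> to the nested pair consisting of
    \<open>A \<inter> B\<close> and \<open>B\<close> produces \<open>A\<close> and
    \<open>A \<union> B\<close>.\<close>
  have "?d (A \<union> B) * ?d (A \<inter> B) \<le> ?d A * ?d B"
    using det_subgraph_prec_union[of "A - B" B "A \<inter> B"] sg[OF sub(1)] unfolding eq by auto
  \<comment> \<open>Taking reciprocals of positive quantities reverses the inequality; the square
    root is multiplicative and preserves it.\<close>
  then have "inverse (?d A * ?d B) \<le> inverse (?d (A \<union> B) * ?d (A \<inter> B))"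
    using sub by (intro le_imp_inverse_le) (auto intro!: mult_pos_pos det_subgraph_prec_pos sg)
  then show ?thesis
    using assms sub
    by (simp add: edge_weight_set_config real_sqrt_mult[symmetric] inverse_mult_distrib)
qed

end

section \<open>Transfer to expectations under the edge distribution\<close>

theorem proposition4:
  fixes \<alpha> \<beta> :: real
    and E :: "'n::finite set set"
    and f g :: "('n set \<Rightarrow> real) \<Rightarrow> real"
  assumes "\<alpha> > 0" and "\<beta> \<ge> 0"
    and "simple_graph E"
    and "increasing_on_configs E f" and "increasing_on_configs E g"
  shows "measure_pmf.expectation (edge_pmf \<alpha> \<beta> E) (\<lambda>a. f a * g a) \<ge>
    measure_pmf.expectation (edge_pmf \<alpha> \<beta> E) f * measure_pmf.expectation (edge_pmf \<alpha> \<beta> E) g"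
proof -
  let ?w = "\<lambda>S. edge_weight \<alpha> \<beta> E (set_config E S)"
  define Z where "Z = (\<Sum>S\<in>Pow E. ?w S)"
  note reindex = sum.reindex_bij_betw[OF bij_betw_set_config, symmetric]
  have wpos: "0 < ?w S" for S
    by (rule edge_weight_pos[OF assms(1-3) set_config_in_configs])
  have Z: "0 < Z"
    unfolding Z_def using wpos by (intro sum_pos) auto
  \<comment> \<open>The support lies in the finite set \<open>configs E\<close>, so the integral is
    a finite sum, reindexed by open-edge sets.\<close>
  have expect: "measure_pmf.expectation (edge_pmf \<alpha> \<beta> E) h =
      (\<Sum>S\<in>Pow E. ?w S * h (set_config E S)) / Z" for h
  proof -
    have "measure_pmf.expectation (edge_pmf \<alpha> \<beta> E) h =
        (\<Sum>a\<in>configs E. h a * pmf (edge_pmf \<alpha> \<beta> E) a)"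
      by (rule integral_measure_pmf_real)
        (auto simp: set_pmf_iff pmf_edge_pmf[OF assms(1-3)] split: if_splits)
    also have "\<dots> = (\<Sum>a\<in>configs E. edge_weight \<alpha> \<beta> E a * h a) / (\<Sum>b\<in>configs E. edge_weight \<alpha> \<beta> E b)"
      unfolding sum_divide_distrib by (rule sum.cong) (auto simp: pmf_edge_pmf[OF assms(1-3)])
    finally show ?thesis
      by (simp add: reindex Z_def)
  qed
  have mono: "mono_on (Pow E) (\<lambda>S. h (set_config E S))" if "increasing_on_configs E h" for h
  proof (rule monotone_onI)
    fix A B assume "A \<subseteq> (B :: 'n set set)"
    then show "h (set_config E A) \<le> h (set_config E B)"
      by (intro monotone_onD[OF that[unfolded increasing_on_configs_def]]
          set_config_in_configs monoD[OF set_config_mono])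
  qed
  have "(\<Sum>S\<in>Pow E. ?w S * f (set_config E S)) * (\<Sum>S\<in>Pow E. ?w S * g (set_config E S)) \<le>
      (\<Sum>S\<in>Pow E. ?w S * (f (set_config E S) * g (set_config E S))) * Z"
    unfolding Z_def
    using assms(4,5)
    by (intro FKG_inequality mono less_imp_le[OF wpos]
        edge_weight_log_supermodular[OF assms(1-3)]) auto
  \<comment> \<open>The product of expectations carries two normalising factors; on the right the
    extra \<open>Z\<close> cancels one of them.\<close>
  then have "(\<Sum>S\<in>Pow E. ?w S * f (set_config E S)) * (\<Sum>S\<in>Pow E. ?w S * g (set_config E S))
      / (Z * Z) \<le>
      (\<Sum>S\<in>Pow E. ?w S * (f (set_config E S) * g (set_config E S))) * Z / (Z * Z)"
    by (rule divide_right_mono) (use Z in simp)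
  then show ?thesis
    using Z by (simp add: expect)
qed

end
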